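(* Every length-factorial monoid (LFM) is a finite factorization monoid (FFM).
   Context: Throughout, "monoid" means cancellative commutative monoid; a monoid $M$ is written additively with identity $0$, and $\mathcal{U}(M)$ denotes its group of invertible elements (units). An element $a \in M \setminus \mathcal{U}(M)$ is an atom if $a = x+y$ with $x,y \in M$ implies that $x$ or $y$ is a unit; $\mathcal{A}(M)$ is the set of atoms. $M$ is atomic if every non-unit element of $M$ is a (finite) sum of atoms. Let $M_{\mathrm{red}} := M/\mathcal{U}(M)$. For an atomic monoid $M$, let $\mathsf{Z}(M)$ be the free commutative monoid of formal sums of elements of $\mathcal{A}(M_{\mathrm{red}})$, and let $\pi \colon \mathsf{Z}(M) \to M_{\mathrm{red}}$ be the unique monoid homomorphism with $\pi(a) = a$ for every $a \in \mathcal{A}(M_{\mathrm{red}})$. The length $|z|$ of $z = a_1 + \cdots + a_\ell \in \mathsf{Z}(M)$ is $\ell$. For $x \in M$, the set of factorizations of $x$ is $\mathsf{Z}(x) := \pi^{-1}(x + \mathcal{U}(M))$. $M$ is a length-factorial monoid (LFM) if it is atomic and for every non-unit $x \in M$ and all $z_1, z_2 \in \mathsf{Z}(x)$, $|z_1| = |z_2|$ implies $z_1 = z_2$. $M$ is a finite factorization monoid (FFM) if it is atomic and $\mathsf{Z}(x)$ is finite for all $x \in M$. *)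

theory Defs
  imports "HOL-Algebra.Divisibility" "HOL-Algebra.FiniteProduct" "HOL-Library.Multiset"
begin

text \<open>
  Cancellative commutative monoids are the structures of the library locale
  \<^locale>\<open>comm_monoid_cancel\<close>. They are written multiplicatively there, so the sum \<open>x + y\<close>
  of the additive notation is \<open>x \<otimes> y\<close>, the identity is \<open>\<one>\<close>, and the coset
  \<open>x + \<U>(M)\<close> is \<open>Units M #> x\<close>.
\<close>

definition monoid_atoms :: "('a, 'b) monoid_scheme \<Rightarrow> 'a set" where
  "monoid_atoms M = {a \<in> carrier M - Units M.
     \<forall>x\<in>carrier M. \<forall>y\<in>carrier M. a = x \<otimes>\<^bsub>M\<^esub> y \<longrightarrow> x \<in> Units M \<or> y \<in> Units M}"

definition reduced_monoid :: "('a, 'b) monoid_scheme \<Rightarrow> 'a set monoid" where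
  "reduced_monoid M = M Mod (Units M)"

definition mset_prod :: "('a, 'b) monoid_scheme \<Rightarrow> 'a multiset \<Rightarrow> 'a" where
  "mset_prod M z = finprod M (\<lambda>a. a [^]\<^bsub>M\<^esub> count z a) (set_mset z)"

text \<open>
  The elements of the free commutative monoid \<open>Z(M)\<close> are the finite multisets of atoms of the
  reduced monoid, with multiset union as operation; the length of \<open>z\<close> is \<^term>\<open>size z\<close>.
\<close>

definition fact_monoid :: "('a, 'b) monoid_scheme \<Rightarrow> 'a set multiset set" where
  "fact_monoid M = {z. set_mset z \<subseteq> monoid_atoms (reduced_monoid M)}"

definition fact_hom :: "('a, 'b) monoid_scheme \<Rightarrow> 'a set multiset \<Rightarrow> 'a set" where
  "fact_hom M = mset_prod (reduced_monoid M)"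

definition factorizations :: "('a, 'b) monoid_scheme \<Rightarrow> 'a \<Rightarrow> 'a set multiset set" where
  "factorizations M x = {z \<in> fact_monoid M. fact_hom M z = Units M #>\<^bsub>M\<^esub> x}"

locale atomic_monoid = comm_monoid_cancel M for M (structure) +
  assumes atomic: "x \<in> carrier M - Units M \<Longrightarrow>
    \<exists>z. set_mset z \<subseteq> monoid_atoms M \<and> mset_prod M z = x"

locale length_factorial_monoid = atomic_monoid +
  assumes length_factorial: "\<lbrakk>x \<in> carrier M - Units M;
    z\<^sub>1 \<in> factorizations M x; z\<^sub>2 \<in> factorizations M x; size z\<^sub>1 = size z\<^sub>2\<rbrakk> \<Longrightarrow> z\<^sub>1 = z\<^sub>2"

locale finite_factorization_monoid = atomic_monoid +
  assumes finite_factorizations: "x \<in> carrier M \<Longrightarrow> finite (factorizations M x)"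

text \<open>
  The remaining facts show that the reduced monoid is again a cancellative commutative monoid and
  that \<^const>\<open>fact_hom\<close> is the unique monoid homomorphism on \<^term>\<open>fact_monoid M\<close> which
  fixes the atoms.
\<close>

lemma (in comm_monoid) mset_prod_closed:
  "set_mset z \<subseteq> carrier G \<Longrightarrow> mset_prod G z \<in> carrier G"
  unfolding mset_prod_def by (rule finprod_closed) auto

lemma (in comm_monoid) mset_prod_empty: "mset_prod G {#} = \<one>"
  by (simp add: mset_prod_def)

lemma (in comm_monoid) mset_prod_single: "a \<in> carrier G \<Longrightarrow> mset_prod G {#a#} = a"
  by (simp add: mset_prod_def)

lemma (in comm_monoid) mset_prod_union:
  assumes "set_mset z \<subseteq> carrier G" "set_mset w \<subseteq> carrier G"
  shows "mset_prod G (z + w) = mset_prod G z \<otimes> mset_prod G w"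
proof -
  let ?S = "set_mset (z + w)"
  have S: "?S \<subseteq> carrier G" using assms by auto
  have ext: "mset_prod G v = finprod G (\<lambda>a. a [^] count v a) ?S"
    if "set_mset v \<subseteq> ?S" for v
    unfolding mset_prod_def
    by (rule finprod_mono_neutral_cong_left) (use that S in \<open>auto simp: not_in_iff\<close>)
  have "mset_prod G (z + w) = finprod G (\<lambda>a. a [^] count z a \<otimes> a [^] count w a) ?S"
    unfolding mset_prod_def
    by (rule finprod_cong') (use S in \<open>auto simp: nat_pow_mult subset_iff\<close>)
  also have "\<dots> = finprod G (\<lambda>a. a [^] count z a) ?S \<otimes> finprod G (\<lambda>a. a [^] count w a) ?S"
    by (rule finprod_multf) (use S in auto)
  also have "\<dots> = mset_prod G z \<otimes> mset_prod G w"
    by (simp add: ext)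
  finally show ?thesis .
qed

lemma (in comm_monoid) mset_prod_unique:
  assumes A: "A \<subseteq> carrier G"
    and "f {#} = \<one>"
    and "\<And>z w. set_mset z \<subseteq> A \<Longrightarrow> set_mset w \<subseteq> A \<Longrightarrow> f (z + w) = f z \<otimes> f w"
    and "\<And>a. a \<in> A \<Longrightarrow> f {#a#} = a"
    and "set_mset z \<subseteq> A"
  shows "f z = mset_prod G z"
  using assms(5)
proof (induction z)
  case empty
  then show ?case by (simp add: assms(2) mset_prod_empty)
next
  case (add a z)
  have "f (z + {#a#}) = f z \<otimes> f {#a#}"
    by (rule assms(3)) (use add.prems in auto)
  moreover have "mset_prod G (z + {#a#}) = mset_prod G z \<otimes> mset_prod G {#a#}"
    by (rule mset_prod_union) (use add.prems A in auto)
  ultimately show ?case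
    using add A assms(4)[of a] by (auto simp: mset_prod_single subset_iff)
qed

context comm_monoid_cancel
begin

lemma units_coset_mult:
  assumes "x \<in> carrier G" "y \<in> carrier G"
  shows "(Units G #> x) <#> (Units G #> y) = Units G #> (x \<otimes> y)"
proof -
  have eq: "u \<otimes> x \<otimes> (v \<otimes> y) = (u \<otimes> v) \<otimes> (x \<otimes> y)"
    if "u \<in> Units G" "v \<in> Units G" for u v
    using assms that Units_closed by (simp add: m_ac)
  show ?thesis
  proof (intro equalityI subsetI)
    fix t assume "t \<in> (Units G #> x) <#> (Units G #> y)"
    then obtain u v where "u \<in> Units G" "v \<in> Units G" "t = u \<otimes> x \<otimes> (v \<otimes> y)"
      unfolding r_coset_def set_mult_def by blast
    then show "t \<in> Units G #> (x \<otimes> y)"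
      unfolding r_coset_def using eq by blast
  next
    fix t assume "t \<in> Units G #> (x \<otimes> y)"
    then obtain u where u: "u \<in> Units G" "t = u \<otimes> (x \<otimes> y)"
      unfolding r_coset_def by blast
    then have "t = u \<otimes> x \<otimes> (\<one> \<otimes> y)"
      using assms by (simp add: Units_closed m_assoc)
    then show "t \<in> (Units G #> x) <#> (Units G #> y)"
      unfolding r_coset_def set_mult_def using u(1) Units_one_closed by blast
  qed
qed

lemma units_coset_eq_iff:
  assumes "x \<in> carrier G" "y \<in> carrier G"
  shows "Units G #> x = Units G #> y \<longleftrightarrow> (\<exists>u\<in>Units G. x = u \<otimes> y)"
proof
  assume "Units G #> x = Units G #> y"
  moreover have "x \<in> Units G #> x"
    unfolding r_coset_def using assms by (auto intro!: bexI[of _ "\<one>"])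
  ultimately show "\<exists>u\<in>Units G. x = u \<otimes> y" unfolding r_coset_def by auto
next
  assume "\<exists>u\<in>Units G. x = u \<otimes> y"
  then obtain u where u: "u \<in> Units G" "x = u \<otimes> y" by blast
  have "v \<otimes> x = (v \<otimes> u) \<otimes> y" if "v \<in> Units G" for v
    using u that assms by (simp add: m_assoc Units_closed)
  moreover have "v \<otimes> y = (v \<otimes> inv u) \<otimes> x" if "v \<in> Units G" for v
  proof -
    have "(v \<otimes> inv u) \<otimes> (u \<otimes> y) = v \<otimes> ((inv u \<otimes> u) \<otimes> y)"
      using u that assms by (simp only: m_assoc Units_closed Units_inv_closed m_closed)
    then show ?thesis using u that assms by (simp add: Units_closed)
  qed
  ultimately show "Units G #> x = Units G #> y"
    unfolding r_coset_def using u(1) by blast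
qed

lemma comm_monoid_cancel_reduced: "comm_monoid_cancel (reduced_monoid G)"
proof (rule comm_monoid_cancelI)
  have one: "Units G #> \<one> = Units G" unfolding r_coset_def by (auto simp: Units_closed)
  have carr: "carrier (reduced_monoid G) = (\<lambda>x. Units G #> x) ` carrier G"
    by (simp add: reduced_monoid_def carrier_FactGroup)
  have mult: "mult (reduced_monoid G) = set_mult G"
    by (simp add: reduced_monoid_def)
  have o: "one (reduced_monoid G) = Units G #> \<one>"
    by (simp add: reduced_monoid_def one)
  show "comm_monoid (reduced_monoid G)"
    by (rule comm_monoidI) (auto simp: carr mult o units_coset_mult m_ac)
  fix a b c
  assume *: "a \<otimes>\<^bsub>reduced_monoid G\<^esub> c = b \<otimes>\<^bsub>reduced_monoid G\<^esub> c"
    and "a \<in> carrier (reduced_monoid G)" "b \<in> carrier (reduced_monoid G)"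
      "c \<in> carrier (reduced_monoid G)"
  then obtain x y w where xyw: "x \<in> carrier G" "y \<in> carrier G" "w \<in> carrier G"
    and abc: "a = Units G #> x" "b = Units G #> y" "c = Units G #> w"
    by (auto simp: carr)
  from * obtain u where u: "u \<in> Units G" "x \<otimes> w = u \<otimes> (y \<otimes> w)"
    using xyw by (auto simp: abc mult units_coset_mult units_coset_eq_iff)
  then have "x \<otimes> w = (u \<otimes> y) \<otimes> w" using xyw by (simp add: m_assoc Units_closed)
  then have "x = u \<otimes> y"
    using xyw u r_cancel[of x w "u \<otimes> y"] by (simp add: Units_closed)
  then show "a = b" using u xyw by (auto simp: abc units_coset_eq_iff)
qed

lemma fact_hom_props:
  shows "fact_hom G {#} = \<one>\<^bsub>reduced_monoid G\<^esub>"
    and "\<lbrakk>z \<in> fact_monoid G; w \<in> fact_monoid G\<rbrakk> \<Longrightarrow>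
      fact_hom G (z + w) = fact_hom G z \<otimes>\<^bsub>reduced_monoid G\<^esub> fact_hom G w"
    and "a \<in> monoid_atoms (reduced_monoid G) \<Longrightarrow> fact_hom G {#a#} = a"
proof -
  interpret R: comm_monoid_cancel "reduced_monoid G" by (rule comm_monoid_cancel_reduced)
  have "monoid_atoms (reduced_monoid G) \<subseteq> carrier (reduced_monoid G)"
    by (auto simp: monoid_atoms_def)
  then show "fact_hom G {#} = \<one>\<^bsub>reduced_monoid G\<^esub>"
    and "\<lbrakk>z \<in> fact_monoid G; w \<in> fact_monoid G\<rbrakk> \<Longrightarrow>
      fact_hom G (z + w) = fact_hom G z \<otimes>\<^bsub>reduced_monoid G\<^esub> fact_hom G w"
    and "a \<in> monoid_atoms (reduced_monoid G) \<Longrightarrow> fact_hom G {#a#} = a"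
    unfolding fact_hom_def fact_monoid_def
    by (auto intro!: R.mset_prod_empty R.mset_prod_union R.mset_prod_single)
qed

lemma fact_hom_unique:
  assumes "f {#} = \<one>\<^bsub>reduced_monoid G\<^esub>"
    and "\<And>z w. \<lbrakk>z \<in> fact_monoid G; w \<in> fact_monoid G\<rbrakk> \<Longrightarrow>
      f (z + w) = f z \<otimes>\<^bsub>reduced_monoid G\<^esub> f w"
    and "\<And>a. a \<in> monoid_atoms (reduced_monoid G) \<Longrightarrow> f {#a#} = a"
    and "z \<in> fact_monoid G"
  shows "f z = fact_hom G z"
proof -
  interpret R: comm_monoid_cancel "reduced_monoid G" by (rule comm_monoid_cancel_reduced)
  show ?thesis
    unfolding fact_hom_def
    by (rule R.mset_prod_unique[of "monoid_atoms (reduced_monoid G)"])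
      (use assms in \<open>auto simp: fact_monoid_def monoid_atoms_def\<close>)
qed

end

end

theory Submission
  imports Defs
begin

text \<open>
  Suppose \<open>z\<^sub>0\<close> and \<open>z\<^sub>1\<close> are factorizations of \<open>x\<close> with \<open>d = |z\<^sub>1| - |z\<^sub>0| > 0\<close>, and let \<open>z\<close> be a third
  one, with \<open>|z| = |z\<^sub>0| + e\<close>. Then \<open>d z + e z\<^sub>0\<close> and \<open>d z\<^sub>0 + e z\<^sub>1\<close> are factorizations of
  \<open>(d + e) x\<close> of the same length, so they coincide. By cancellation \<open>z\<^sub>0\<close> does not divide \<open>z\<^sub>1\<close>, so some
  atom \<open>a\<close> occurs more often in \<open>z\<^sub>0\<close> than in \<open>z\<^sub>1\<close>; comparing its multiplicities bounds \<open>e\<close> by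
  \<open>d\<close> times its multiplicity in \<open>z\<^sub>0\<close>. Hence the lengths of the factorizations of \<open>x\<close> are bounded,
  and each length occurs at most once.
\<close>

lemma set_mset_repeat_mset_subset: "set_mset (repeat_mset n z) \<subseteq> set_mset z"
  by (induction n) auto

lemma (in comm_monoid) mset_prod_repeat_cong:
  assumes "set_mset z \<subseteq> carrier G" "set_mset w \<subseteq> carrier G" "mset_prod G z = mset_prod G w"
  shows "mset_prod G (repeat_mset n z) = mset_prod G (repeat_mset n w)"
proof (induction n)
  case (Suc n)
  have "set_mset (repeat_mset n v) \<subseteq> carrier G" if "set_mset v \<subseteq> carrier G" for v
    using set_mset_repeat_mset_subset that by (rule subset_trans)
  then show ?case
    using Suc assms by (simp add: mset_prod_union)
qed simp

text \<open>Any factor of the identity is invertible, whereas atoms are not.\<close>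

lemma (in comm_monoid) mset_prod_atoms_eq_one:
  assumes "set_mset z \<subseteq> monoid_atoms G" "mset_prod G z = \<one>"
  shows "z = {#}"
proof (rule ccontr)
  assume "z \<noteq> {#}"
  then obtain a w where z: "z = {#a#} + w"
    by (metis add_mset_add_single multiset_cases union_commute)
  have a: "a \<in> carrier G" "a \<notin> Units G" and w: "set_mset w \<subseteq> carrier G"
    using assms(1) by (auto simp: z monoid_atoms_def)
  have "a \<otimes> mset_prod G w = \<one>"
    using assms(2) a w mset_prod_union[of "{#a#}" w] by (simp add: z mset_prod_single)
  then have "a \<in> Units G"
    using a mset_prod_closed[OF w] m_comm[of a "mset_prod G w"] by (auto simp: Units_def)
  then show False using a by simp
qed

text \<open>The hypothesis \<open>inj\<close> ranges over all products, not only \<open>r\<close>,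
  because it is applied to factorizations of a multiple of \<open>r\<close>.\<close>

lemma (in comm_monoid_cancel) finite_mset_prod_fibre:
  assumes A: "A \<subseteq> carrier G"
    and one: "\<And>z. set_mset z \<subseteq> A \<Longrightarrow> mset_prod G z = \<one> \<Longrightarrow> z = {#}"
    and inj: "\<And>z w. set_mset z \<subseteq> A \<Longrightarrow> set_mset w \<subseteq> A \<Longrightarrow>
      mset_prod G z = mset_prod G w \<Longrightarrow> size z = size w \<Longrightarrow> z = w"
  shows "finite {z. set_mset z \<subseteq> A \<and> mset_prod G z = r}" (is "finite ?Z")
proof -
  have "\<exists>b. \<forall>z\<in>?Z. size z \<le> b"
  proof (rule ccontr)
    assume unb: "\<nexists>b. \<forall>z\<in>?Z. size z \<le> b"
    then obtain z\<^sub>0 where z0: "z\<^sub>0 \<in> ?Z" by blast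
    obtain z\<^sub>1 where z1: "z\<^sub>1 \<in> ?Z" "size z\<^sub>0 < size z\<^sub>1"
      using unb not_le by blast
    define d where "d = size z\<^sub>1 - size z\<^sub>0"
    have "\<not> z\<^sub>0 \<subseteq># z\<^sub>1"
    proof
      assume "z\<^sub>0 \<subseteq># z\<^sub>1"
      then obtain t where t: "z\<^sub>1 = z\<^sub>0 + t" by (auto simp: mset_subset_eq_exists_conv)
      have sub: "set_mset z\<^sub>0 \<subseteq> carrier G" "set_mset t \<subseteq> A" "set_mset t \<subseteq> carrier G"
        using z0 z1 A by (auto simp: t)
      have "mset_prod G z\<^sub>0 \<otimes> mset_prod G t = mset_prod G z\<^sub>0 \<otimes> \<one>"
        using z0 z1 sub mset_prod_union[of z\<^sub>0 t] mset_prod_closed[of z\<^sub>0] by (simp add: t)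
      then have "mset_prod G t = \<one>"
        by (rule l_cancel) (simp_all add: sub mset_prod_closed)
      then have "t = {#}" using one sub by blast
      then show False using z1 by (simp add: t)
    qed
    then obtain a where a: "count z\<^sub>1 a < count z\<^sub>0 a"
      by (auto simp: subseteq_mset_def not_le)
    \<comment> \<open>The threshold is chosen so that the excess length \<open>e\<close> is greater
      than \<open>d * count z\<^sub>0 a\<close>, the bound refuted below.\<close>
    obtain z where z: "z \<in> ?Z" "size z\<^sub>0 + d * count z\<^sub>0 a < size z"
      using unb not_le by blast
    define e where "e = size z - size z\<^sub>0"
    have sizes: "size z = size z\<^sub>0 + e" "size z\<^sub>1 = size z\<^sub>0 + d"
      using z z1 by (simp_all add: e_def d_def)
    have sub: "set_mset (repeat_mset n v) \<subseteq> A" "set_mset (repeat_mset n v) \<subseteq> carrier G"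
      if "v \<in> ?Z" for n v
      using that A set_mset_repeat_mset_subset[of n v] by auto
    have cong: "mset_prod G (repeat_mset n v) = mset_prod G (repeat_mset n w)"
      if "v \<in> ?Z" "w \<in> ?Z" for n v w
      by (rule mset_prod_repeat_cong) (use that A in auto)
    \<comment> \<open>The products agree summand by summand: \<open>z\<close> is exchanged for
      \<open>z\<^sub>0\<close> in the first and \<open>z\<^sub>0\<close> for
      \<open>z\<^sub>1\<close> in the second.\<close>
    have "repeat_mset d z + repeat_mset e z\<^sub>0 = repeat_mset d z\<^sub>0 + repeat_mset e z\<^sub>1"
    proof (rule inj)
      show "mset_prod G (repeat_mset d z + repeat_mset e z\<^sub>0) =
          mset_prod G (repeat_mset d z\<^sub>0 + repeat_mset e z\<^sub>1)"
        using sub(2)[OF z(1)] sub(2)[OF z0] sub(2)[OF z1(1)] cong[OF z(1) z0] cong[OF z0 z1(1)]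
        by (simp add: mset_prod_union)
    next
      show "size (repeat_mset d z + repeat_mset e z\<^sub>0) =
          size (repeat_mset d z\<^sub>0 + repeat_mset e z\<^sub>1)"
        by (simp add: sizes algebra_simps)
    qed (use sub(1)[OF z(1)] sub(1)[OF z0] sub(1)[OF z1(1)] in auto)
    from arg_cong[OF this, of "\<lambda>m. count m a"]
    have eq: "d * count z a + e * count z\<^sub>0 a = d * count z\<^sub>0 a + e * count z\<^sub>1 a" by simp
    have "e * count z\<^sub>1 a + e \<le> e * count z\<^sub>0 a"
      using mult_le_mono2[of "Suc (count z\<^sub>1 a)" "count z\<^sub>0 a" e] a by simp
    \<comment> \<open>The gap of at least one between the two multiplicities of \<open>a\<close>
      leaves a full \<open>e\<close> after cancelling \<open>e * count z\<^sub>1 a\<close> in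
      \<open>eq\<close>.\<close>
    then have "e \<le> d * count z\<^sub>0 a" using eq by linarith
    then show False using z(2) sizes by simp
  qed
  then obtain b where "\<forall>z\<in>?Z. size z \<le> b" by blast
  then have "size ` ?Z \<subseteq> {..b}" by auto
  moreover have "inj_on size ?Z"
    by (rule inj_onI) (auto intro: inj)
  ultimately show ?thesis
    using finite_imageD finite_subset by blast
qed

text \<open>Length-factoriality speaks of non-units only; this settles the units, whose coset is the
  identity of the reduced monoid.\<close>

lemma (in comm_monoid_cancel) factorizations_unit:
  assumes "x \<in> Units G" "z \<in> factorizations G x"
  shows "z = {#}"
proof -
  interpret R: comm_monoid_cancel "reduced_monoid G" by (rule comm_monoid_cancel_reduced)
  have "Units G #> x = Units G #> \<one>"
    using assms(1) units_coset_eq_iff[of x \<one>] by (auto simp: Units_closed)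
  also have "\<dots> = \<one>\<^bsub>reduced_monoid G\<^esub>"
    by (auto simp: r_coset_def reduced_monoid_def Units_closed)
  finally show ?thesis
    using assms(2) R.mset_prod_atoms_eq_one[of z]
    by (simp add: factorizations_def fact_monoid_def fact_hom_def)
qed

lemma (in length_factorial_monoid) factorization_eqI:
  assumes "x \<in> carrier M" "z \<in> factorizations M x" "w \<in> factorizations M x" "size z = size w"
  shows "z = w"
proof (cases "x \<in> Units M")
  case True
  then show ?thesis using assms(2,3) factorizations_unit[of x z] factorizations_unit[of x w] by simp
next
  case False
  then show ?thesis using assms by (intro length_factorial[of x]) auto
qed

theorem proposition3p1:
  fixes M :: "('a, 'b) monoid_scheme"
  assumes "length_factorial_monoid M"
  shows "finite_factorization_monoid M"
proof -
  interpret length_factorial_monoid M by (rule assms)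
  interpret R: comm_monoid_cancel "reduced_monoid M" by (rule comm_monoid_cancel_reduced)
  let ?A = "monoid_atoms (reduced_monoid M)"
  have A: "?A \<subseteq> carrier (reduced_monoid M)" by (auto simp: monoid_atoms_def)
  have inj: "z = w" if "set_mset z \<subseteq> ?A" "set_mset w \<subseteq> ?A"
    "mset_prod (reduced_monoid M) z = mset_prod (reduced_monoid M) w" "size z = size w" for z w
  proof -
    \<comment> \<open>The common product is a coset of some \<open>x\<close>, so \<open>z\<close>
      and \<open>w\<close> are both factorizations of that \<open>x\<close>.\<close>
    have "mset_prod (reduced_monoid M) z \<in> carrier (reduced_monoid M)"
      using that(1) A by (intro R.mset_prod_closed) blast
    then obtain x where "x \<in> carrier M" "mset_prod (reduced_monoid M) z = Units M #>\<^bsub>M\<^esub> x"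
      by (auto simp: reduced_monoid_def carrier_FactGroup)
    then show "z = w"
      using that factorization_eqI[of x z w]
      by (simp add: factorizations_def fact_monoid_def fact_hom_def)
  qed
  have "finite (factorizations M x)" for x
    unfolding factorizations_def fact_monoid_def fact_hom_def mem_Collect_eq
    by (rule R.finite_mset_prod_fibre[OF A R.mset_prod_atoms_eq_one inj])
  then show ?thesis by unfold_locales
qed

end
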